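(* Let $k\in\mathbb{N}\cup\{\infty,\omega\}$ with $k\ge 1$, let $I\subset\mathbb{R}$ be an open interval, and let $\phi:I\to\mathbb{R}$ be a $\mathcal{C}^k$ function whose derivative does not vanish on $I$. Put $\Delta=\phi(I)$ and assume that the addition domain $\mathcal{D}_I=\{(\xi,\eta)\in\Delta\times\Delta : \phi^{-1}(\xi)+\phi^{-1}(\eta)\in I\}$ is non-empty. Then $\phi$ has a $\mathcal{C}^k$ double-angle formula, that is, there exists a $\mathcal{C}^k$ function $R$, defined on $\{\phi(t) : t\in I,\ 2t\in I\}$, such that $\phi(2t)=R(\phi(t))$ for all $t\in I$ with $2t\in I$.
   Context: $\mathcal{C}^\omega$ denotes the class of real analytic functions. Since $\phi$ has non-vanishing derivative on the interval $I$, it is a $\mathcal{C}^k$ diffeomorphism from $I$ onto the open interval $\Delta=\phi(I)$, with inverse $\phi^{-1}:\Delta\to I$. A double-angle formula for $\phi$ is a one-variable function $R$ with $\phi(2t)=R(\phi(t))$. *)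

theory Defs
  imports "HOL-Analysis.Analysis"
begin

datatype smoothness = Finite_Order nat | Infinite_Order | Real_Analytic

text \<open>
  The three predicates below are meant for an open set \<open>S\<close>: derivatives are two-sided, and
  the values of \<open>f\<close> outside \<open>S\<close> play no role.
\<close>

fun Cn_on :: "nat \<Rightarrow> (real \<Rightarrow> real) \<Rightarrow> real set \<Rightarrow> bool" where
  "Cn_on 0 f S \<longleftrightarrow> continuous_on S f"
| "Cn_on (Suc n) f S \<longleftrightarrow> (\<forall>x\<in>S. f differentiable (at x)) \<and> Cn_on n (deriv f) S"

definition real_analytic_on :: "(real \<Rightarrow> real) \<Rightarrow> real set \<Rightarrow> bool" where
  "real_analytic_on f S \<longleftrightarrow> (\<forall>x\<in>S. \<exists>F. (\<lambda>h. f (x + h)) has_fps_expansion F)"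

fun smooth_on :: "smoothness \<Rightarrow> (real \<Rightarrow> real) \<Rightarrow> real set \<Rightarrow> bool" where
  "smooth_on (Finite_Order n) f S \<longleftrightarrow> Cn_on n f S"
| "smooth_on Infinite_Order f S \<longleftrightarrow> (\<forall>n. Cn_on n f S)"
| "smooth_on Real_Analytic f S \<longleftrightarrow> real_analytic_on f S"

text \<open>
  Here \<open>inv_into I \<phi>\<close> is the inverse of \<open>\<phi> : I \<rightarrow> \<phi> ` I\<close>; it is used only for \<open>\<phi>\<close> with
  non-vanishing derivative on an interval \<open>I\<close>, hence injective on \<open>I\<close>.
\<close>

definition addition_domain :: "(real \<Rightarrow> real) \<Rightarrow> real set \<Rightarrow> (real \<times> real) set" where
  "addition_domain \<phi> I =
     {(\<xi>, \<eta>) \<in> \<phi> ` I \<times> \<phi> ` I. inv_into I \<phi> \<xi> + inv_into I \<phi> \<eta> \<in> I}"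

end

theory Submission
  imports Defs "HOL-Complex_Analysis.Complex_Analysis"
begin

text \<open>
  A function with non-vanishing derivative on an interval has an inverse of its own smoothness
  class, so \<open>R x = \<phi> (2 * \<phi>\<^sup>-\<^sup>1 x)\<close> is a composition of three maps of class \<open>C\<^sup>k\<close>: the inverse
  \<open>\<phi>\<^sup>-\<^sup>1\<close>, doubling and \<open>\<phi>\<close>. Its natural domain is the image under \<open>\<phi>\<close> of the open set of all
  \<open>t \<in> I\<close> with \<open>2 * t \<in> I\<close>, which is the set on which a double-angle formula is asked for.

  What has to be supplied is that each class is closed under composition (\<open>smooth_on_compose\<close>)
  and under inversion (\<open>smooth_on_inv_into\<close>). For finite order both go by induction on the order,
  using \<open>(g \<circ> f)' = (g' \<circ> f) * f'\<close> and \<open>(\<phi>\<^sup>-\<^sup>1)' = 1 / (\<phi>' \<circ> \<phi>\<^sup>-\<^sup>1)\<close>, once closure under sums,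
  products and reciprocals is known. In the analytic case no power series is composed or
  reverted: a real function is analytic at a point exactly when it agrees near that point with a
  holomorphic function (\<open>real_analytic_on_iff_complex_extension\<close>), and holomorphic functions
  compose and have holomorphic local inverses where their derivative is not zero.
\<close>

section \<open>Functions of finite order of smoothness\<close>

lemma Cn_on_cong:
  assumes "open S"
  shows "Cn_on n f S \<Longrightarrow> \<forall>x\<in>S. f x = g x \<Longrightarrow> Cn_on n g S"
proof (induction n arbitrary: f g)
  case 0
  then show ?case
    using continuous_on_cong by force
next
  case (Suc n)
  have ev: "\<forall>\<^sub>F y in nhds x. f y = g y" if "x \<in> S" for x
    using eventually_nhds_in_open[OF assms that] Suc.prems(2) by (auto elim!: eventually_mono)
  have "g differentiable (at x)" if "x \<in> S" for x
  proof -
    have "(f has_real_derivative deriv f x) (at x)"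
      using Suc.prems(1) that by (simp add: DERIV_deriv_iff_real_differentiable)
    then have "(g has_real_derivative deriv f x) (at x)"
      using DERIV_cong_ev[OF refl ev[OF that] refl] by blast
    then show ?thesis
      using real_differentiable_def by blast
  qed
  moreover have "Cn_on n (deriv g) S"
    by (rule Suc.IH[of "deriv f"]) (use Suc.prems(1) ev in \<open>auto intro!: deriv_cong_ev\<close>)
  ultimately show ?case by simp
qed

text \<open>
  It is enough to exhibit the derivative by a formula that is valid on \<open>S\<close>. This is how the
  inductions on the order proceed: the rules of differentiation express the derivative through
  functions that are already known to have one order less.
\<close>

lemma Cn_on_SucI:
  assumes "open S" "\<And>x. x \<in> S \<Longrightarrow> (f has_real_derivative f' x) (at x)" "Cn_on n f' S"
  shows "Cn_on (Suc n) f S"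
proof -
  have "Cn_on n (deriv f) S"
    using Cn_on_cong[OF assms(1,3), of "deriv f"] assms(2) by (metis DERIV_imp_deriv)
  then show ?thesis
    using assms(2) by (auto simp: real_differentiable_def)
qed

lemma Cn_on_SucD_DERIV:
  "Cn_on (Suc n) f S \<Longrightarrow> x \<in> S \<Longrightarrow> (f has_real_derivative deriv f x) (at x)"
  by (simp add: DERIV_deriv_iff_real_differentiable)

lemma Cn_on_imp_continuous_on: "Cn_on n f S \<Longrightarrow> continuous_on S f"
  by (cases n)
    (auto intro!: continuous_at_imp_continuous_on differentiable_imp_continuous_within)

lemma Cn_on_SucD: "Cn_on (Suc n) f S \<Longrightarrow> Cn_on n f S"
proof (induction n arbitrary: f)
  case 0
  then show ?case
    using Cn_on_imp_continuous_on by (metis Cn_on.simps(1))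
qed auto

lemma Cn_on_subset: "Cn_on n f T \<Longrightarrow> S \<subseteq> T \<Longrightarrow> Cn_on n f S"
  by (induction n arbitrary: f) (auto intro: continuous_on_subset)

lemma Cn_on_const: "Cn_on n (\<lambda>x. c) S"
  by (induction n arbitrary: c) auto

lemma Cn_on_add:
  assumes "open S"
  shows "Cn_on n f S \<Longrightarrow> Cn_on n g S \<Longrightarrow> Cn_on n (\<lambda>x. f x + g x) S"
proof (induction n arbitrary: f g)
  case (Suc n)
  show ?case
  proof (rule Cn_on_SucI[OF assms])
    show "((\<lambda>x. f x + g x) has_real_derivative deriv f x + deriv g x) (at x)" if "x \<in> S" for x
      using Suc.prems that by (intro DERIV_add Cn_on_SucD_DERIV)
  qed (use Suc in auto)
qed (auto intro: continuous_on_add)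

lemma Cn_on_mult:
  assumes "open S"
  shows "Cn_on n f S \<Longrightarrow> Cn_on n g S \<Longrightarrow> Cn_on n (\<lambda>x. f x * g x) S"
proof (induction n arbitrary: f g)
  case (Suc n)
  show ?case
  proof (rule Cn_on_SucI[OF assms])
    show "((\<lambda>x. f x * g x) has_real_derivative deriv f x * g x + deriv g x * f x) (at x)"
      if "x \<in> S" for x
      using Suc.prems that by (intro DERIV_mult Cn_on_SucD_DERIV)
    show "Cn_on n (\<lambda>x. deriv f x * g x + deriv g x * f x) S"
      using Suc.prems Cn_on_SucD by (intro Cn_on_add[OF assms] Suc.IH) auto
  qed
qed (auto intro: continuous_on_mult)

lemma Cn_on_compose:
  assumes "open S" "open T" "f ` S \<subseteq> T"
  shows "Cn_on n f S \<Longrightarrow> Cn_on n g T \<Longrightarrow> Cn_on n (\<lambda>x. g (f x)) S"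
proof (induction n arbitrary: g)
  case 0
  then show ?case
    using assms(3) by (auto intro: continuous_on_compose2)
next
  case (Suc n)
  show ?case
  proof (rule Cn_on_SucI[OF assms(1)])
    show "((\<lambda>x. g (f x)) has_real_derivative deriv g (f x) * deriv f x) (at x)" if "x \<in> S" for x
      using Suc.prems that assms(3) by (intro DERIV_chain2 Cn_on_SucD_DERIV) auto
    show "Cn_on n (\<lambda>x. deriv g (f x) * deriv f x) S"
    proof (rule Cn_on_mult[OF assms(1)])
      show "Cn_on n (\<lambda>x. deriv g (f x)) S"
        using Suc.IH Cn_on_SucD[OF Suc.prems(1)] Suc.prems(2) by simp
    qed (use Suc.prems(1) in simp)
  qed
qed

lemma Cn_on_inverse:
  assumes "open S" "\<And>x. x \<in> S \<Longrightarrow> f x \<noteq> 0"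
  shows "Cn_on n f S \<Longrightarrow> Cn_on n (\<lambda>x. inverse (f x)) S"
proof (induction n)
  case 0
  then show ?case
    using assms(2) by (auto intro: continuous_on_inverse)
next
  case (Suc n)
  show ?case
  proof (rule Cn_on_SucI[OF assms(1)])
    show "((\<lambda>x. inverse (f x)) has_real_derivative
            - 1 * (inverse (f x) * deriv f x * inverse (f x))) (at x)" if "x \<in> S" for x
      using DERIV_inverse'[OF Cn_on_SucD_DERIV[OF Suc.prems that] assms(2)[OF that]] by simp
    show "Cn_on n (\<lambda>x. - 1 * (inverse (f x) * deriv f x * inverse (f x))) S"
      using Suc Cn_on_SucD by (intro Cn_on_mult[OF assms(1)] Cn_on_const) auto
  qed
qed

section \<open>Inverting a function with non-vanishing derivative\<close>

text \<open>By Rolle, equal values at two points would produce a zero of the derivative between them.\<close>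

lemma inj_on_interval_if_deriv_nonzero:
  fixes f :: "real \<Rightarrow> real"
  assumes "is_interval I" "\<And>x. x \<in> I \<Longrightarrow> f differentiable (at x)" "\<And>x. x \<in> I \<Longrightarrow> deriv f x \<noteq> 0"
  shows "inj_on f I"
proof -
  have neq: "f a \<noteq> f b" if "a \<in> I" "b \<in> I" "a < b" for a b
  proof
    assume eq: "f a = f b"
    have sub: "x \<in> I" if "a \<le> x" "x \<le> b" for x
      using mem_is_interval_1_I[OF assms(1) \<open>a \<in> I\<close> \<open>b \<in> I\<close> that] .
    have "continuous_on {a..b} f"
      using sub assms(2)
      by (auto intro!: continuous_at_imp_continuous_on differentiable_imp_continuous_within)
    then obtain z where "a < z" "z < b" "deriv f z = 0"
      using Rolle_deriv[OF \<open>a < b\<close> eq, of "\<lambda>x h. deriv f x * h"] sub assms(2)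
      by (metis DERIV_deriv_iff_real_differentiable has_field_derivative_def less_imp_le
          mult.right_neutral)
    then show False
      using assms(3) sub by simp
  qed
  show ?thesis
    by (rule inj_onI) (metis neq less_linear)
qed

text \<open>
  In dimension one an injective continuous map sends open sets to open sets. This makes the inverse
  continuous, and a continuous inverse is differentiable wherever the derivative of the map is
  not zero.
\<close>

lemma deriv_nonzero_imp_inverse:
  fixes f :: "real \<Rightarrow> real"
  assumes "open I" "is_interval I" "\<And>x. x \<in> I \<Longrightarrow> f differentiable (at x)"
    "\<And>x. x \<in> I \<Longrightarrow> deriv f x \<noteq> 0"
  shows "inj_on f I" "\<And>U. open U \<Longrightarrow> U \<subseteq> I \<Longrightarrow> open (f ` U)"
    "continuous_on (f ` I) (inv_into I f)"
    "\<And>y. y \<in> f ` I \<Longrightarrow>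
       (inv_into I f has_real_derivative inverse (deriv f (inv_into I f y))) (at y)"
proof -
  show inj: "inj_on f I"
    using assms inj_on_interval_if_deriv_nonzero by blast
  have cont: "continuous_on I f"
    using assms(3)
    by (auto intro!: continuous_at_imp_continuous_on differentiable_imp_continuous_within)
  show op: "open (f ` U)" if "open U" "U \<subseteq> I" for U
    using that inj cont injective_into_1d_imp_open_map_UNIV by blast
  show contg: "continuous_on (f ` I) (inv_into I f)"
  proof (rule continuous_on_inverse_open_map[OF cont refl])
    show "openin (top_of_set (f ` I)) (f ` U)" if "openin (top_of_set I) U" for U
      using that op assms(1) by (metis openin_open_eq open_subset openin_imp_subset image_mono)
  qed (simp add: inj)
  show "(inv_into I f has_real_derivative inverse (deriv f (inv_into I f y))) (at y)"
    if y: "y \<in> f ` I" for y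
  proof (rule has_field_derivative_inverse_basic)
    show "(f has_real_derivative deriv f (inv_into I f y)) (at (inv_into I f y))"
      using assms(3) inv_into_into[OF y] by (simp add: DERIV_deriv_iff_real_differentiable)
    show "continuous (at y) (inv_into I f)"
      using contg op[OF assms(1)] y continuous_on_eq_continuous_at by blast
  qed (use assms(4) inv_into_into[OF y] op[OF assms(1)] y in \<open>auto intro: f_inv_into_f\<close>)
qed

text \<open>
  The derivative \<open>1 / (f' \<circ> f\<^sup>-\<^sup>1)\<close> of the inverse involves the inverse itself, but the order of
  smoothness of \<open>f\<^sup>-\<^sup>1\<close> that it needs is one less than the order to be proved.
\<close>

lemma Cn_on_inv_into:
  assumes "open I" "is_interval I" "\<And>x. x \<in> I \<Longrightarrow> deriv f x \<noteq> 0"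
  shows "Cn_on (Suc n) f I \<Longrightarrow> Cn_on (Suc n) (inv_into I f) (f ` I)"
proof -
  have step: "Cn_on (Suc m) (inv_into I f) (f ` I)"
    if f: "Cn_on (Suc m) f I" and g: "Cn_on m (inv_into I f) (f ` I)" for m
  proof -
    have d: "\<And>x. x \<in> I \<Longrightarrow> f differentiable (at x)"
      using f by simp
    note inv = deriv_nonzero_imp_inverse[OF assms(1,2) d assms(3)]
    have op: "open (f ` I)"
      using inv(2) assms(1) by blast
    have into: "inv_into I f ` f ` I \<subseteq> I"
      by (auto intro: inv_into_into)
    have "Cn_on m (\<lambda>y. deriv f (inv_into I f y)) (f ` I)"
      using Cn_on_compose[OF op assms(1) into g] f by simp
    then have "Cn_on m (\<lambda>y. inverse (deriv f (inv_into I f y))) (f ` I)"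
      using op assms(3) into by (intro Cn_on_inverse) auto
    with inv(4) show ?thesis
      by (rule Cn_on_SucI[OF op])
  qed
  show "Cn_on (Suc n) f I \<Longrightarrow> Cn_on (Suc n) (inv_into I f) (f ` I)"
  proof (induction n)
    case 0
    note inv = deriv_nonzero_imp_inverse[OF assms(1,2) _ assms(3)]
    have "Cn_on 0 (inv_into I f) (f ` I)"
      using inv(3) 0 by simp
    from step[OF 0 this] show ?case .
  next
    case (Suc n)
    then have "Cn_on (Suc n) (inv_into I f) (f ` I)"
      using Cn_on_SucD by blast
    from step[OF Suc.prems this] show ?case .
  qed
qed

section \<open>Real analyticity through holomorphic extensions\<close>

definition complex_extension :: "(complex \<Rightarrow> complex) \<Rightarrow> (real \<Rightarrow> real) \<Rightarrow> real \<Rightarrow> bool" where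
  "complex_extension g f x \<longleftrightarrow>
     g analytic_on {of_real x} \<and> (\<forall>\<^sub>F t in nhds x. g (of_real t) = of_real (f t))"

lemma complex_extension_at: "complex_extension g f x \<Longrightarrow> g (of_real x) = of_real (f x)"
  unfolding complex_extension_def using eventually_nhds_x_imp_x by blast

text \<open>
  A real power series, read with a complex argument, has the same radius of convergence.
  Conversely, the real parts of the Taylor coefficients of the extension give a power series
  for \<open>f\<close>, because \<open>f\<close> and the powers of \<open>t - x\<close> are real.
\<close>

lemma real_analytic_on_iff_complex_extension:
  "real_analytic_on f S \<longleftrightarrow> (\<forall>x\<in>S. \<exists>g. complex_extension g f x)"
proof -
  have "(\<exists>F. (\<lambda>h. f (x + h)) has_fps_expansion F) \<longleftrightarrow> (\<exists>g. complex_extension g f x)" for x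
  proof
    assume "\<exists>F. (\<lambda>h. f (x + h)) has_fps_expansion F"
    then obtain F where F: "fps_conv_radius F > 0" "\<forall>\<^sub>F h in nhds 0. eval_fps F h = f (x + h)"
      unfolding has_fps_expansion_def by blast
    define G :: "complex fps" where "G = Abs_fps (\<lambda>n. of_real (fps_nth F n))"
    define g where "g = (\<lambda>z. eval_fps G (z - of_real x))"
    have rad: "fps_conv_radius G = fps_conv_radius F"
      unfolding fps_conv_radius_def G_def by (rule conv_radius_cong) simp
    have "(\<lambda>h. g (of_real x + h)) has_fps_expansion G"
      using F(1) by (simp add: g_def rad eval_fps_has_fps_expansion)
    then have "g analytic_on {of_real x}"
      by (rule has_fps_expansion_imp_analytic)
    moreover have "\<forall>\<^sub>F h in nhds 0. g (of_real (x + h)) = of_real (f (x + h))"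
    proof -
      have "\<forall>\<^sub>F h in nhds 0. h \<in> eball 0 (fps_conv_radius F)"
        using F(1) by (intro eventually_nhds_in_open) (auto simp: zero_ereal_def)
      with F(2) show ?thesis
      proof eventually_elim
        case (elim h)
        then have "ereal (norm h) < fps_conv_radius F"
          by simp
        from sums_eval_fps[OF this]
        have "(\<lambda>n. of_real (fps_nth F n * h ^ n) :: complex) sums of_real (eval_fps F h)"
          by (rule sums_of_real)
        then have "(\<lambda>n. fps_nth G n * of_real h ^ n) sums of_real (eval_fps F h)"
          by (simp add: G_def)
        then have "eval_fps G (of_real h) = of_real (eval_fps F h)"
          unfolding eval_fps_def[where f = G] by (rule sums_unique[symmetric])
        with elim(1) show ?case
          by (simp add: g_def)
      qed
    qed
    then have "\<forall>\<^sub>F t in nhds x. g (of_real t) = of_real (f t)"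
      by (simp add: nhds_to_0[of x] eventually_filtermap add.commute)
    ultimately show "\<exists>g. complex_extension g f x"
      unfolding complex_extension_def by blast
  next
    assume "\<exists>g. complex_extension g f x"
    then obtain g where g: "g analytic_on {of_real x}"
        "\<forall>\<^sub>F t in nhds x. g (of_real t) = of_real (f t)"
      unfolding complex_extension_def by blast
    define G where "G = fps_expansion g (of_real x)"
    have G: "fps_conv_radius G > 0" "\<forall>\<^sub>F z in nhds 0. eval_fps G z = g (of_real x + z)"
      using analytic_at_imp_has_fps_expansion[OF g(1)] unfolding G_def has_fps_expansion_def by auto
    have "\<forall>\<^sub>F z in nhds 0. z \<in> eball 0 (fps_conv_radius G)"
      using G(1) by (intro eventually_nhds_in_open) (auto simp: zero_ereal_def)
    with G(2) have "\<forall>\<^sub>F z in nhds 0. (\<lambda>n. fps_nth G n * z ^ n) sums g (of_real x + z)"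
    proof eventually_elim
      case (elim z)
      then show ?case
        using sums_eval_fps[of z G] by simp
    qed
    moreover have "filterlim (of_real :: real \<Rightarrow> complex) (nhds 0) (nhds 0)"
      using tendsto_of_real[OF filterlim_ident[of "nhds (0::real)"]] by simp
    ultimately have "\<forall>\<^sub>F h in nhds (0::real).
        (\<lambda>n. fps_nth G n * of_real h ^ n) sums g (of_real x + of_real h)"
      by (rule eventually_compose_filterlim)
    moreover have "\<forall>\<^sub>F h in nhds 0. g (of_real (x + h)) = of_real (f (x + h))"
      using g(2) by (simp add: nhds_to_0[of x] eventually_filtermap add.commute)
    ultimately have "\<forall>\<^sub>F h in nhds 0. (\<lambda>n. fps_nth (Abs_fps (\<lambda>n. Re (fps_nth G n))) n * h ^ n)
        sums f (x + h)"
    proof eventually_elim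
      case (elim h)
      from sums_Re[OF elim(1)] elim(2) show ?case
        by (simp flip: of_real_power)
    qed
    then show "\<exists>F. (\<lambda>h. f (x + h)) has_fps_expansion F"
      by (blast intro: has_fps_expansionI)
  qed
  then show ?thesis
    unfolding real_analytic_on_def by simp
qed

text \<open>
  Along the real axis the extension is real-valued, so its complex derivative is a limit of real
  difference quotients.
\<close>

lemma complex_extension_deriv:
  assumes "complex_extension g f x"
  shows "f differentiable (at x)" "deriv g (of_real x) = of_real (deriv f x)"
proof -
  have ev: "\<forall>\<^sub>F t in nhds x. g (of_real t) = of_real (f t)"
    using assms by (simp add: complex_extension_def)
  have "(g has_field_derivative deriv g (of_real x)) (at (of_real x))"
    using assms unfolding complex_extension_def DERIV_deriv_iff_field_differentiable
    by (auto intro: analytic_on_imp_differentiable_at)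
  then have "((\<lambda>t. g (of_real t)) has_vector_derivative deriv g (of_real x)) (at x)"
    by (rule has_vector_derivative_real_field)
  then have d: "((\<lambda>t. complex_of_real (f t)) has_vector_derivative deriv g (of_real x)) (at x)"
    using has_vector_derivative_cong_ev[of UNIV "\<lambda>t. g (of_real t)" "\<lambda>t. of_real (f t)" x]
      ev complex_extension_at[OF assms] by simp
  from bounded_linear.has_vector_derivative[OF bounded_linear_Re d]
  have re: "(f has_real_derivative Re (deriv g (of_real x))) (at x)"
    by (simp add: has_real_derivative_iff_has_vector_derivative)
  then show "f differentiable (at x)"
    by (auto simp: real_differentiable_def)
  have "((\<lambda>t. complex_of_real (f t)) has_vector_derivative
          of_real (Re (deriv g (of_real x)))) (at x)"
    using re has_vector_derivative_of_real has_real_derivative_iff_has_vector_derivative by blast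
  then have "deriv g (of_real x) = of_real (Re (deriv g (of_real x)))"
    using d vector_derivative_unique_at by blast
  with re show "deriv g (of_real x) = of_real (deriv f x)"
    by (metis DERIV_imp_deriv)
qed

lemma complex_extension_compose:
  assumes f: "complex_extension F f x" and g: "complex_extension G g (f x)"
  shows "complex_extension (G \<circ> F) (\<lambda>t. g (f t)) x"
  unfolding complex_extension_def
proof
  show "G \<circ> F analytic_on {of_real x}"
    using f g complex_extension_at[OF f] unfolding complex_extension_def
    by (intro analytic_on_compose_gen[where T = "{of_real (f x)}"]) auto
  have "filterlim f (nhds (f x)) (nhds x)"
    using complex_extension_deriv(1)[OF f] differentiable_imp_continuous_within
    by (metis continuous_at tendsto_at_iff_tendsto_nhds)
  then have "\<forall>\<^sub>F t in nhds x. G (of_real (f t)) = of_real (g (f t))"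
    using g eventually_compose_filterlim unfolding complex_extension_def by fast
  moreover have "\<forall>\<^sub>F t in nhds x. F (of_real t) = of_real (f t)"
    using f by (simp add: complex_extension_def)
  ultimately show "\<forall>\<^sub>F t in nhds x. (G \<circ> F) (of_real t) = of_real (g (f t))"
    by eventually_elim simp
qed

text \<open>
  The extension of \<open>f\<close> has a holomorphic inverse near \<open>f x\<close>. That inverse extends the given real
  one because the latter is continuous: its values near \<open>f x\<close> stay in the disc on which the
  extension is injective.
\<close>

lemma complex_extension_inverse:
  assumes f: "complex_extension F f x" and "deriv f x \<noteq> 0"
    and "isCont g (f x)" "g (f x) = x" "\<forall>\<^sub>F y in nhds (f x). f (g y) = y"
  obtains G where "complex_extension G g (f x)"
proof -
  obtain S where S: "open S" "of_real x \<in> S" "F holomorphic_on S"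
    using f unfolding complex_extension_def analytic_at by blast
  have "deriv F (of_real x) \<noteq> 0"
    using complex_extension_deriv(2)[OF f] assms(2) by simp
  then obtain r where r: "r > 0" "ball (of_real x) r \<subseteq> S" "open (F ` ball (of_real x) r)"
      "inj_on F (ball (of_real x) r)"
    using has_complex_derivative_locally_invertible[OF S(3,2,1)] by metis
  then obtain G where G: "G holomorphic_on (F ` ball (of_real x) r)"
      "\<And>z. z \<in> ball (of_real x) r \<Longrightarrow> G (F z) = z"
    using holomorphic_has_inverse[of F "ball (of_real x) r"] S(3) holomorphic_on_subset
    by (metis open_ball)
  have "of_real (f x) \<in> F ` ball (of_real x) r"
    using complex_extension_at[OF f] r(1) by (metis centre_in_ball image_eqI)
  then have "G analytic_on {of_real (f x)}"
    using G(1) r(3) holomorphic_on_imp_analytic_at by blast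
  moreover have "\<forall>\<^sub>F y in nhds (f x). G (of_real y) = of_real (g y)"
  proof -
    have lim: "filterlim g (nhds x) (nhds (f x))"
      using assms(3,4) by (metis continuous_at tendsto_at_iff_tendsto_nhds)
    have "\<forall>\<^sub>F t in nhds x. F (of_real t) = of_real (f t)"
      using f by (simp add: complex_extension_def)
    moreover have "\<forall>\<^sub>F t in nhds x. t \<in> ball x r"
      using r(1) by (intro eventually_nhds_in_open) auto
    ultimately have "\<forall>\<^sub>F t in nhds x. G (of_real (f t)) = of_real t"
    proof eventually_elim
      case (elim t)
      then show ?case
        using G(2)[of "of_real t"] by (simp add: dist_of_real)
    qed
    from eventually_compose_filterlim[OF this lim] assms(5) show ?thesis
      by eventually_elim simp
  qed
  ultimately show thesis
    using that unfolding complex_extension_def by blast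
qed

section \<open>Closure properties common to all smoothness classes\<close>

lemma smooth_on_subset: "smooth_on k f T \<Longrightarrow> S \<subseteq> T \<Longrightarrow> smooth_on k f S"
  by (cases k) (auto intro: Cn_on_subset simp: real_analytic_on_def)

lemma smooth_on_imp_differentiable:
  assumes "smooth_on k f S" "k \<noteq> Finite_Order 0" "x \<in> S"
  shows "f differentiable (at x)"
proof (cases k)
  case (Finite_Order n)
  then show ?thesis
    using assms by (cases n) auto
next
  case Infinite_Order
  then have "Cn_on (Suc 0) f S"
    using assms(1) by (simp only: smooth_on.simps)
  then show ?thesis
    using assms(3) by simp
next
  case Real_Analytic
  then show ?thesis
    using assms complex_extension_deriv(1) real_analytic_on_iff_complex_extension
    by (metis smooth_on.simps(3))
qed

lemma smooth_on_compose:
  assumes "open S" "open T" "f ` S \<subseteq> T" "smooth_on k f S" "smooth_on k g T"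
  shows "smooth_on k (\<lambda>x. g (f x)) S"
proof (cases k)
  case Real_Analytic
  have "\<exists>H. complex_extension H (\<lambda>x. g (f x)) x" if x: "x \<in> S" for x
  proof -
    obtain F where "complex_extension F f x"
      using assms(4) Real_Analytic x
      by (metis real_analytic_on_iff_complex_extension smooth_on.simps(3))
    moreover obtain G where "complex_extension G g (f x)"
      using assms(3,5) Real_Analytic x
      by (metis image_subset_iff real_analytic_on_iff_complex_extension smooth_on.simps(3))
    ultimately show ?thesis
      using complex_extension_compose by blast
  qed
  with Real_Analytic show ?thesis
    by (simp add: real_analytic_on_iff_complex_extension)
qed (use assms Cn_on_compose[OF assms(1-3)] in auto)

lemma smooth_on_cmult:
  assumes "open S"
  shows "smooth_on k (\<lambda>x. c * x) S"
proof -
  have "Cn_on n (\<lambda>x. c * x) S" for n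
  proof (cases n)
    case (Suc m)
    have "Cn_on (Suc m) (\<lambda>x. c * x) S"
      using assms by (rule Cn_on_SucI[where f' = "\<lambda>x. c"])
        (auto intro!: derivative_eq_intros Cn_on_const)
    with Suc show ?thesis by simp
  qed (auto intro: continuous_intros)
  moreover have "complex_extension (\<lambda>z. of_real c * z) (\<lambda>x. c * x) x" for x
    unfolding complex_extension_def by (auto intro!: analytic_intros)
  ultimately show ?thesis
    by (cases k) (auto simp: real_analytic_on_iff_complex_extension)
qed

lemma smooth_on_inv_into:
  assumes "k \<noteq> Finite_Order 0" "open I" "is_interval I" "smooth_on k f I"
    and nz: "\<And>x. x \<in> I \<Longrightarrow> deriv f x \<noteq> 0"
  shows "smooth_on k (inv_into I f) (f ` I)"
proof (cases k)
  case (Finite_Order n)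
  then obtain m where "n = Suc m"
    using assms(1) by (cases n) auto
  with Finite_Order show ?thesis
    using Cn_on_inv_into[OF assms(2,3) nz] assms(4) by (simp del: Cn_on.simps)
next
  case Infinite_Order
  then have "Cn_on (Suc n) (inv_into I f) (f ` I)" for n
    using Cn_on_inv_into[OF assms(2,3) nz] assms(4) by (simp only: smooth_on.simps)
  with Infinite_Order show ?thesis
    by (auto intro: Cn_on_SucD simp del: Cn_on.simps)
next
  case Real_Analytic
  note inv = deriv_nonzero_imp_inverse[OF assms(2,3)
      smooth_on_imp_differentiable[OF assms(4,1)] nz]
  have op: "open (f ` I)"
    using inv(2) assms(2) by blast
  have "\<exists>G. complex_extension G (inv_into I f) (f x)" if x: "x \<in> I" for x
  proof -
    obtain F where "complex_extension F f x"
      using assms(4) Real_Analytic x by (auto simp: real_analytic_on_iff_complex_extension)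
    moreover have "isCont (inv_into I f) (f x)"
      using inv(3) op x by (simp add: continuous_on_eq_continuous_at)
    moreover have "\<forall>\<^sub>F y in nhds (f x). f (inv_into I f y) = y"
      using eventually_nhds_in_open[OF op, of "f x"] x
      by (auto elim!: eventually_mono intro: f_inv_into_f)
    moreover have "inv_into I f (f x) = x"
      using inv(1) x by simp
    ultimately show ?thesis
      using complex_extension_inverse[of F f x "inv_into I f"] nz[OF x] by blast
  qed
  with Real_Analytic show ?thesis
    by (auto simp: real_analytic_on_iff_complex_extension)
qed

section \<open>The double-angle formula\<close>

theorem corollary3p1:
  fixes k :: smoothness and I :: "real set" and \<phi> :: "real \<Rightarrow> real"
  assumes "k \<noteq> Finite_Order 0"
    and "open I" and "is_interval I"
    and "smooth_on k \<phi> I"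
    and "\<forall>t\<in>I. deriv \<phi> t \<noteq> 0"
    and "addition_domain \<phi> I \<noteq> {}"
  shows "\<exists>R :: real \<Rightarrow> real.
           smooth_on k R {\<phi> t | t. t \<in> I \<and> 2 * t \<in> I} \<and>
           (\<forall>t\<in>I. 2 * t \<in> I \<longrightarrow> \<phi> (2 * t) = R (\<phi> t))"
proof -
  have nz: "\<And>x. x \<in> I \<Longrightarrow> deriv \<phi> x \<noteq> 0"
    using assms(5) by blast
  note inv = deriv_nonzero_imp_inverse[OF assms(2,3)
      smooth_on_imp_differentiable[OF assms(4,1)] nz]
  define J where "J = {t. t \<in> I \<and> 2 * t \<in> I}"
  have "J = I \<inter> (\<lambda>t. 2 * t) -` I"
    by (auto simp: J_def)
  moreover have "open ((\<lambda>t::real. 2 * t) -` I)"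
    using assms(2) by (intro open_vimage continuous_intros)
  ultimately have J: "open J" "J \<subseteq> I"
    using assms(2) by auto
  have opJ: "open (\<phi> ` J)"
    using inv(2) J by blast
  have inv_J: "inv_into I \<phi> (\<phi> t) = t" if "t \<in> J" for t
    using inv(1) J(2) that by auto
  have "smooth_on k (inv_into I \<phi>) (\<phi> ` J)"
    using smooth_on_inv_into[OF assms(1-4) nz] J(2) smooth_on_subset image_mono by metis
  then have "smooth_on k (\<lambda>x. 2 * inv_into I \<phi> x) (\<phi> ` J)"
    by (rule smooth_on_compose[OF opJ open_UNIV subset_UNIV _ smooth_on_cmult[OF open_UNIV]])
  moreover have "(\<lambda>x. 2 * inv_into I \<phi> x) ` \<phi> ` J \<subseteq> I"
    using inv_J by (auto simp: J_def)
  ultimately have "smooth_on k (\<lambda>x. \<phi> (2 * inv_into I \<phi> x)) (\<phi> ` J)"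
    using smooth_on_compose[OF opJ assms(2) _ _ assms(4)] by simp
  moreover have "\<phi> ` J = {\<phi> t | t. t \<in> I \<and> 2 * t \<in> I}"
    by (auto simp: J_def)
  moreover have "\<forall>t\<in>I. 2 * t \<in> I \<longrightarrow> \<phi> (2 * t) = \<phi> (2 * inv_into I \<phi> (\<phi> t))"
    using inv_J by (simp add: J_def)
  ultimately show ?thesis
    by (intro exI[of _ "\<lambda>x. \<phi> (2 * inv_into I \<phi> x)"]) simp
qed

end
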